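(* Let $V\neq\emptyset$ be a finite set and let $(\Delta,\sigma)$ be a subdivision of the simplex $2^V$. Then $$\ell_V(\Delta,x)=\sum_{F\subseteq V}\big[h(\Delta_F,x)-h(\partial(\Delta_F),x)\big]\cdot\mathfrak{d}_{|V\setminus F|}(x).$$
   Context: For a simplicial complex $K$ of dimension $e-1$ with $f_{i-1}(K)$ faces of cardinality $i$, $h(K,x)=\sum_{i=0}^{e} f_{i-1}(K)x^i(1-x)^{e-i}$. A subdivision of $2^V$ is a pair $(\Delta,\sigma)$, $\Delta$ a finite simplicial complex, $\sigma:\Delta\to 2^V$ a map such that for each $F\subseteq V$, $\Delta_F:=\sigma^{-1}(2^F)$ is a subcomplex homeomorphic to a ball of dimension $|F|-1$ and $\sigma^{-1}(F)$ is the set of interior faces of $\Delta_F$. The local $h$-polynomial is $\ell_V(\Delta,x)=\sum_{F\subseteq V}(-1)^{|V|-|F|}h(\Delta_F,x)$. For $F\neq\emptyset$, $\partial(\Delta_F)=\bigcup_{G\subsetneq F}\Delta_G$ is the boundary of the ball $\Delta_F$, a complex of dimension $|F|-2$ whose $h$-polynomial is computed with $e=|F|-1$; for $F=\emptyset$ the convention is $h(\Delta_\emptyset,x)-h(\partial(\Delta_\emptyset),x)=1$ (i.e., $h(\Delta_\emptyset,x)=1$ and $h(\partial(\Delta_\emptyset),x)=0$). For $\pi\in S_n$, $\mathrm{exc}(\pi)=|\{i:\pi(i)>i\}|$; $\mathfrak{d}_n(x)=\sum_{\pi}x^{\mathrm{exc}(\pi)}$, the sum over fixed-point-free $\pi\in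 S_n$, for $n\geq1$, and $\mathfrak{d}_0(x)=1$. *)

theory Defs
  imports
    "HOL-Analysis.Analysis"
    "HOL-Computational_Algebra.Polynomial"
    "HOL-Combinatorics.Permutations"
begin

definition fin_simplicial_complex :: "'a set set \<Rightarrow> bool" where
  "fin_simplicial_complex K \<longleftrightarrow>
     finite K \<and> (\<forall>E\<in>K. finite E) \<and> (\<forall>E\<in>K. \<forall>D. D \<subseteq> E \<longrightarrow> D \<in> K)"

text \<open>Barycentric coordinates; the subspace topology of the product topology is the usual
  topology because only finite complexes are considered.\<close>

definition realization_points :: "'a set set \<Rightarrow> ('a \<Rightarrow> real) set" where
  "realization_points K =
     {p. (\<forall>v. 0 \<le> p v) \<and> {v. p v \<noteq> 0} \<in> K \<and> (\<Sum>v\<in>{v. p v \<noteq> 0}. p v) = 1}"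

definition realization :: "'a set set \<Rightarrow> ('a \<Rightarrow> real) topology" where
  "realization K = subtopology (powertop_real UNIV) (realization_points K)"

definition closed_ball_top :: "nat \<Rightarrow> (nat \<Rightarrow> real) topology" where
  "closed_ball_top n = subtopology (Euclidean_space n) {x. (\<Sum>i<n. (x i)\<^sup>2) \<le> 1}"

text \<open>The only ball of dimension \<open>-1\<close> is the complex whose single face is the empty set.\<close>

definition is_ball_of_dim :: "'a set set \<Rightarrow> int \<Rightarrow> bool" where
  "is_ball_of_dim K d \<longleftrightarrow>
     (d = -1 \<and> K = {{}}) \<or>
     (d \<ge> 0 \<and> realization K homeomorphic_space closed_ball_top (nat d))"

text \<open>Points corresponding to the bounding sphere of a topological ball. By invariance of domain
  the choice of the homeomorphism is irrelevant.\<close>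

definition ball_boundary_points :: "'b topology \<Rightarrow> 'b set" where
  "ball_boundary_points X =
     {p \<in> topspace X. \<exists>n f. homeomorphic_map X (closed_ball_top n) f \<and> (\<Sum>i<n. (f p i)\<^sup>2) = 1}"

text \<open>A face of a ball is interior if it is not contained in the boundary of the ball. The empty
  face lies in the boundary of every ball of dimension at least \<open>0\<close>, but the boundary of the
  \<open>-1\<close>-dimensional ball has no faces at all.\<close>

definition interior_faces :: "'a set set \<Rightarrow> 'a set set" where
  "interior_faces K =
     (if K = {{}} then {{}}
      else {E \<in> K. \<not> realization_points (Pow E) \<subseteq> ball_boundary_points (realization K)})"

definition restr :: "'a set set \<Rightarrow> ('a set \<Rightarrow> 'v set) \<Rightarrow> 'v set \<Rightarrow> 'a set set" where
  "restr \<Delta> \<sigma> F = {E \<in> \<Delta>. \<sigma> E \<subseteq> F}"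

definition restr_boundary :: "'a set set \<Rightarrow> ('a set \<Rightarrow> 'v set) \<Rightarrow> 'v set \<Rightarrow> 'a set set" where
  "restr_boundary \<Delta> \<sigma> F = (\<Union>G\<in>{G. G \<subset> F}. restr \<Delta> \<sigma> G)"

definition is_subdivision :: "'v set \<Rightarrow> 'a set set \<Rightarrow> ('a set \<Rightarrow> 'v set) \<Rightarrow> bool" where
  "is_subdivision V \<Delta> \<sigma> \<longleftrightarrow>
     fin_simplicial_complex \<Delta> \<and>
     (\<forall>E\<in>\<Delta>. \<sigma> E \<subseteq> V) \<and>
     (\<forall>F. F \<subseteq> V \<longrightarrow>
        fin_simplicial_complex (restr \<Delta> \<sigma> F) \<and>
        is_ball_of_dim (restr \<Delta> \<sigma> F) (int (card F) - 1) \<and>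
        {E \<in> \<Delta>. \<sigma> E = F} = interior_faces (restr \<Delta> \<sigma> F))"

definition num_faces :: "'a set set \<Rightarrow> nat \<Rightarrow> nat" where
  "num_faces K i = card {E \<in> K. card E = i}"

text \<open>Here \<open>e - 1\<close> is the dimension of \<open>K\<close>. For the void complex \<open>{}\<close> all face numbers vanish,
  so the value is \<open>0\<close> whatever \<open>e\<close> is.\<close>

definition h_poly :: "'a set set \<Rightarrow> int poly" where
  "h_poly K = (let e = Max (card ` K) in
     \<Sum>i=0..e. of_nat (num_faces K i) * [:0, 1:] ^ i * [:1, -1:] ^ (e - i))"

definition local_h_poly :: "'v set \<Rightarrow> 'a set set \<Rightarrow> ('a set \<Rightarrow> 'v set) \<Rightarrow> int poly" where
  "local_h_poly V \<Delta> \<sigma> =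
     (\<Sum>F\<in>Pow V. (-1) ^ (card V - card F) * h_poly (restr \<Delta> \<sigma> F))"

definition exc :: "nat \<Rightarrow> (nat \<Rightarrow> nat) \<Rightarrow> nat" where
  "exc n \<pi> = card {i \<in> {1..n}. \<pi> i > i}"

definition derangement_poly :: "nat \<Rightarrow> int poly" where
  "derangement_poly n =
     (\<Sum>\<pi> | \<pi> permutes {1..n} \<and> (\<forall>i\<in>{1..n}. \<pi> i \<noteq> i). [:0, 1:] ^ exc n \<pi>)"

lemma derangement_poly_0: "derangement_poly 0 = 1"
  by (simp add: derangement_poly_def exc_def)

lemma h_poly_void: "h_poly {} = 0"
  by (simp add: h_poly_def num_faces_def)

lemma h_poly_empty_face: "h_poly {{}} = 1"
proof -
  have "{E. E = {} \<and> card E = 0} = {{} :: 'a set}"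
    by auto
  then show ?thesis
    by (simp add: h_poly_def num_faces_def)
qed

lemma restr_boundary_empty: "restr_boundary \<Delta> \<sigma> {} = {}"
  by (simp add: restr_boundary_def)

end

theory Submission
  imports Defs "HOL-Homology.Invariance_of_Domain"
begin

text \<open>Let \<open>g(G)\<close> be the sum of \<open>x\<^bsup>|E|\<^esup> (1-x)\<^bsup>|G|-|E|\<^esup>\<close> over the faces \<open>E\<close> with carrier \<open>G\<close>. By invariance
  of domain all facets of a triangulated \<open>n\<close>-ball have \<open>n + 1\<close> vertices, so the exponents in all
  \<open>h\<close>-polynomials are known: as functions of \<open>F\<close>, the polynomials \<open>h(\<Delta>\<^sub>F)\<close> and
  \<open>h(\<Delta>\<^sub>F) - h(\<partial>\<Delta>\<^sub>F)\<close> are the convolutions over subsets of \<open>g\<close> with the sequences \<open>(1-x)\<^bsup>k\<^esup>\<close> and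
  \<open>c\<^sub>k\<close>, where \<open>c\<^sub>0 = 1\<close> and \<open>c\<^sub>k = (1-x)\<^bsup>k\<^esup> - (1-x)\<^bsup>k-1\<^esup>\<close> for \<open>k \<ge> 1\<close>.
  By associativity it suffices that \<open>(1-x)\<^bsup>k\<^esup> * (-1)\<^bsup>k\<^esup> = c * d\<close> for the binomial convolution \<open>*\<close> and
  the derangement polynomials \<open>d\<close>.

  Moebius inversion over the supports of permutations gives \<open>d = A * (-1)\<^bsup>k\<^esup>\<close> with the Eulerian
  polynomials \<open>A\<close>, so it remains to see that \<open>c * A = (1-x)\<^bsup>k\<^esup>\<close>. The operator sending
  \<open>a\<^sub>n\<close> to \<open>n x a\<^sub>n + x (1-x) a\<^sub>n'\<close> is a derivation of \<open>*\<close>, and the sequences \<open>c\<close>, \<open>A\<close>, \<open>(1-x)\<^bsup>k\<^esup>\<close> satisfy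
  \<open>a\<^bsub>n+1\<^esub> = u a\<^sub>n + n x a\<^sub>n + x (1-x) a\<^sub>n'\<close> with \<open>u = -x\<close>, \<open>1\<close>, \<open>1-x\<close> respectively.\<close>

section \<open>Dimension of triangulated balls\<close>

lemma continuous_map_Euclidean_space_coordinate:
  "continuous_map (Euclidean_space n) euclideanreal (\<lambda>x. x i)"
  unfolding Euclidean_space_def
  by (intro continuous_map_from_subtopology continuous_map_product_projection) auto

lemma openin_Euclidean_space_subset_imp_le:
  assumes "openin (Euclidean_space m) S" "S \<noteq> {}" "S \<subseteq> topspace (Euclidean_space n)"
  shows "m \<le> n"
proof (rule ccontr)
  assume "\<not> m \<le> n"
  then have "n < m" by simp
  obtain q where q: "q \<in> S" using assms(2) by blast
  then have q_0: "q i = 0" if "i \<ge> n" for i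
    using assms(3) that by (auto simp: topspace_Euclidean_space)
  define line where "line = (\<lambda>t::real. q(n := t))"
  have "continuous_map euclideanreal euclideanreal (\<lambda>t. line t i)" for i
    by (cases "i = n") (simp_all add: line_def)
  moreover have "line t i = 0" if "i \<ge> m" for t i
    using that \<open>n < m\<close> q_0 by (simp add: line_def)
  ultimately have "continuous_map euclideanreal (Euclidean_space m) line"
    by (auto simp: Euclidean_space_def continuous_map_in_subtopology continuous_map_componentwise_UNIV)
  then have "openin euclideanreal {t \<in> topspace euclideanreal. line t \<in> S}"
    using assms(1) by (rule openin_continuous_map_preimage)
  moreover have "{t \<in> topspace euclideanreal. line t \<in> S} = {0}"
  proof -
    have "line 0 = q" using q_0[of n] by (auto simp: line_def)
    moreover have "t = 0" if "line t \<in> S" for t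
      using subsetD[OF assms(3) that] by (auto simp: topspace_Euclidean_space line_def)
    ultimately show ?thesis using q by auto
  qed
  ultimately show False
    using not_open_singleton[of "0::real"] by simp
qed

lemma Euclidean_space_injective_imp_le:
  assumes U: "openin (Euclidean_space m) U" "U \<noteq> {}"
    and f: "continuous_map (subtopology (Euclidean_space m) U) (Euclidean_space n) f"
    and inj: "inj_on f U"
  shows "m \<le> n"
proof (rule ccontr)
  assume "\<not> m \<le> n"
  then have "Euclidean_space n = subtopology (Euclidean_space m) (topspace (Euclidean_space n))"
    by (simp add: Euclidean_space_def subtopology_subtopology Int_absorb1 Collect_mono)
  then have "continuous_map (subtopology (Euclidean_space m) U) (Euclidean_space m) f"
    using f by (metis continuous_map_into_fulltopology)
  then have "openin (Euclidean_space m) (f ` U)"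
    by (rule invariance_of_domain_Euclidean_space[OF U(1) _ inj])
  moreover have "f ` U \<subseteq> topspace (Euclidean_space n)"
    using continuous_map_image_subset_topspace[OF f] openin_subset[OF U(1)] by (simp add: Int_absorb1)
  ultimately have "m \<le> n"
    using U(2) by (intro openin_Euclidean_space_subset_imp_le) auto
  with \<open>\<not> m \<le> n\<close> show False ..
qed

lemma homeomorphic_Euclidean_subspaces_imp_le:
  assumes hom: "subtopology (Euclidean_space m) S homeomorphic_space
      subtopology (Euclidean_space n) T"
    and U: "openin (Euclidean_space m) U" "U \<noteq> {}" "U \<subseteq> S"
  shows "m \<le> n"
proof -
  obtain f g where fg: "homeomorphic_maps (subtopology (Euclidean_space m) S)
      (subtopology (Euclidean_space n) T) f g"
    using hom by (auto simp: homeomorphic_space_def)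
  have "continuous_map (subtopology (Euclidean_space m) S) (Euclidean_space n) f"
    using fg by (auto simp: homeomorphic_maps_def intro: continuous_map_into_fulltopology)
  then have "continuous_map (subtopology (Euclidean_space m) U) (Euclidean_space n) f"
    using U(3) by (rule continuous_map_from_subtopology_mono)
  moreover have "inj_on f U"
    using fg U(3) openin_subset[OF U(1)]
    by (intro inj_on_inverseI[of _ g]) (auto simp: homeomorphic_maps_def)
  ultimately show ?thesis
    by (rule Euclidean_space_injective_imp_le[OF U(1,2)])
qed

lemma openin_Euclidean_space_contains_contraction:
  assumes T: "openin (Euclidean_space n) T" and p: "p \<in> T"
  obtains t where "0 \<le> t" "t < 1" "(\<lambda>i. t * p i) \<in> T"
proof -
  define ray where "ray = (\<lambda>t i. t * p i)"
  have "p i = 0" if "i \<ge> n" for i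
    using p openin_subset[OF T] that by (auto simp: topspace_Euclidean_space)
  then have "continuous_map euclideanreal (Euclidean_space n) ray"
    by (auto simp: ray_def Euclidean_space_def continuous_map_in_subtopology
        continuous_map_componentwise_UNIV intro!: continuous_intros)
  then have "open {t. ray t \<in> T}"
    using openin_continuous_map_preimage[OF _ T] by fastforce
  moreover have "ray 1 \<in> T" using p by (simp add: ray_def)
  ultimately obtain e where "e > 0" and e: "\<And>t. dist t 1 < e \<Longrightarrow> ray t \<in> T"
    by (metis mem_Collect_eq open_dist)
  define t where "t = max 0 (1 - e / 2)"
  have "0 \<le> t" "t < 1" "dist t 1 < e"
    using \<open>e > 0\<close> by (auto simp: t_def dist_real_def)
  with e that show thesis by (simp add: ray_def)
qed

lemma openin_closed_ball_top_contains_openin_Euclidean_space: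
  assumes W: "openin (closed_ball_top n) W" "W \<noteq> {}"
  obtains U where "openin (Euclidean_space n) U" "U \<noteq> {}" "U \<subseteq> W"
proof -
  define sqnorm where "sqnorm = (\<lambda>x::nat \<Rightarrow> real. \<Sum>i<n. (x i)\<^sup>2)"
  obtain T where T: "openin (Euclidean_space n) T" and W_eq: "W = T \<inter> {x. sqnorm x \<le> 1}"
    using W(1) by (auto simp: closed_ball_top_def openin_subtopology sqnorm_def)
  have "openin (Euclidean_space n) {x \<in> topspace (Euclidean_space n). sqnorm x \<in> {..<1}}"
    unfolding sqnorm_def
    by (rule openin_continuous_map_preimage[where Y = euclideanreal])
       (intro continuous_intros continuous_map_Euclidean_space_coordinate, auto)
  with T have "openin (Euclidean_space n) (T \<inter> {x \<in> topspace (Euclidean_space n). sqnorm x \<in> {..<1}})"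
    by (rule openin_Int)
  also have "T \<inter> {x \<in> topspace (Euclidean_space n). sqnorm x \<in> {..<1}} = T \<inter> {x. sqnorm x < 1}"
    using openin_subset[OF T] by auto
  finally have "openin (Euclidean_space n) (T \<inter> {x. sqnorm x < 1})" .
  moreover have "T \<inter> {x. sqnorm x < 1} \<noteq> {}"
  proof -
    obtain p where p: "p \<in> T" "sqnorm p \<le> 1" using W(2) W_eq by blast
    obtain t where t: "0 \<le> t" "t < 1" "(\<lambda>i. t * p i) \<in> T"
      using openin_Euclidean_space_contains_contraction[OF T p(1)] .
    have "sqnorm (\<lambda>i. t * p i) = t\<^sup>2 * sqnorm p"
      by (simp add: sqnorm_def power_mult_distrib sum_distrib_left)
    also have "\<dots> \<le> t\<^sup>2" using p(2) by (simp add: mult_left_le)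
    also have "\<dots> < 1" using t by (simp add: power_less_one_iff abs_square_less_1)
    finally show ?thesis using t(3) by blast
  qed
  moreover have "T \<inter> {x. sqnorm x < 1} \<subseteq> W" by (auto simp: W_eq)
  ultimately show thesis by (rule that)
qed

lemma open_subspace_homeomorphic_open_in_ball_imp_eq:
  assumes S: "openin (Euclidean_space m) S" "S \<noteq> {}"
    and W: "openin (closed_ball_top n) W"
    and hom: "subtopology (Euclidean_space m) S homeomorphic_space subtopology (closed_ball_top n) W"
  shows "m = n"
proof -
  have "subtopology (closed_ball_top n) W = subtopology (Euclidean_space n) W"
    using openin_subset[OF W] by (simp add: closed_ball_top_def subtopology_subtopology Int_absorb1)
  with hom have hom: "subtopology (Euclidean_space m) S homeomorphic_space
      subtopology (Euclidean_space n) W"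
    by simp
  then have "m \<le> n"
    using S order_refl by (rule homeomorphic_Euclidean_subspaces_imp_le)
  moreover have "W \<noteq> {}"
  proof
    assume "W = {}"
    then have "topspace (subtopology (Euclidean_space m) S) = {}"
      using homeomorphic_empty_space[OF hom] by simp
    then show False
      using S openin_subset[OF S(1)] by (simp add: Int_absorb1)
  qed
  then obtain U where U: "openin (Euclidean_space n) U" "U \<noteq> {}" "U \<subseteq> W"
    using openin_closed_ball_top_contains_openin_Euclidean_space[OF W] by blast
  have "subtopology (Euclidean_space n) W homeomorphic_space subtopology (Euclidean_space m) S"
    using hom by (subst homeomorphic_space_sym)
  then have "n \<le> m"
    using U by (rule homeomorphic_Euclidean_subspaces_imp_le)
  ultimately show ?thesis by simp
qed

definition open_simplex :: "'a set \<Rightarrow> ('a \<Rightarrow> real) set" where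
  "open_simplex E = {p. (\<forall>v\<in>E. 0 < p v) \<and> (\<forall>v. v \<notin> E \<longrightarrow> p v = 0) \<and> sum p E = 1}"

definition facet :: "'a set set \<Rightarrow> 'a set \<Rightarrow> bool" where
  "facet K E \<longleftrightarrow> E \<in> K \<and> (\<forall>D\<in>K. E \<subseteq> D \<longrightarrow> D = E)"

lemma open_simplex_eq_support:
  "open_simplex E = {p. (\<forall>v. 0 \<le> p v) \<and> {v. p v \<noteq> 0} = E \<and> sum p E = 1}"
proof -
  have "(\<forall>v\<in>E. 0 < p v) \<and> (\<forall>v. v \<notin> E \<longrightarrow> p v = 0) \<longleftrightarrow> (\<forall>v. 0 \<le> p v) \<and> {v. p v \<noteq> 0} = E"
    for p :: "'a \<Rightarrow> real"
    unfolding set_eq_iff mem_Collect_eq by (metis less_le order_refl)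
  then show ?thesis by (simp add: open_simplex_def flip: conj_assoc)
qed

lemma realization_points_eq_Union_open_simplex: "realization_points K = \<Union> (open_simplex ` K)"
  by (auto simp: realization_points_def open_simplex_eq_support)

lemma openin_open_simplex_facet:
  assumes E: "facet K E" and fin: "finite E"
  shows "openin (realization K) (open_simplex E)"
proof -
  have "continuous_map (realization K) euclideanreal (\<lambda>p. p v)" for v
    unfolding realization_def
    by (intro continuous_map_from_subtopology continuous_map_product_projection) auto
  then have "openin (realization K) {p \<in> topspace (realization K). (\<Prod>v\<in>E. p v) \<in> - {0}}"
    using fin by (intro openin_continuous_map_preimage[where Y = euclideanreal] continuous_map_prod)
                 (auto simp: open_Compl)
  also have "{p \<in> topspace (realization K). (\<Prod>v\<in>E. p v) \<in> - {0}} =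
      {p \<in> realization_points K. E \<subseteq> {v. p v \<noteq> 0}}"
    using fin by (auto simp: realization_def)
  also have "\<dots> = open_simplex E"
    using E by (auto simp: facet_def realization_points_def open_simplex_eq_support)
  finally show ?thesis .
qed

lemma continuous_map_relabel_open_simplex:
  assumes b: "bij_betw b D E"
  shows "continuous_map (subtopology (powertop_real UNIV) (open_simplex E))
    (subtopology (powertop_real UNIV) (open_simplex D)) (\<lambda>p v. if v \<in> D then p (b v) else 0)"
    (is "continuous_map _ _ ?relabel")
proof -
  have "continuous_map (powertop_real UNIV) (powertop_real UNIV) ?relabel"
    by (auto simp: continuous_map_componentwise_UNIV intro: continuous_map_product_projection)
  moreover have "?relabel p \<in> open_simplex D" if "p \<in> open_simplex E" for p
  proof -
    have "sum (?relabel p) D = sum p E"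
      using sum.reindex_bij_betw[OF b, of p] by simp
    with that bij_betwE[OF b] show ?thesis by (simp add: open_simplex_def)
  qed
  ultimately show ?thesis
    by (auto simp: continuous_map_in_subtopology continuous_map_from_subtopology)
qed

lemma homeomorphic_open_simplexes:
  assumes "finite D" "finite E" "card D = card E"
  shows "subtopology (powertop_real UNIV) (open_simplex D) homeomorphic_space
    subtopology (powertop_real UNIV) (open_simplex E)"
proof -
  obtain b where b: "bij_betw b D E"
    using finite_same_card_bij[OF assms] by blast
  define c where "c = inv_into D b"
  have c: "bij_betw c E D"
    using b unfolding c_def by (rule bij_betw_inv_into)
  have cb: "c (b v) = v" "b v \<in> E" if "v \<in> D" for v
    using b that by (auto simp: c_def bij_betw_def)
  have bc: "b (c v) = v" "c v \<in> D" if "v \<in> E" for v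
    using b that bij_betwE[OF c] by (auto simp: c_def bij_betw_inv_into_right)
  show ?thesis
    unfolding homeomorphic_space_def homeomorphic_maps_def
    using continuous_map_relabel_open_simplex[OF c] continuous_map_relabel_open_simplex[OF b] cb bc
    by (intro exI conjI) (auto simp: open_simplex_def fun_eq_iff)
qed

definition barycentric :: "nat \<Rightarrow> (nat \<Rightarrow> real) \<Rightarrow> nat \<Rightarrow> real" where
  "barycentric m x i = (if i < m then x i else if i = m then 1 - (\<Sum>j<m. x j) else 0)"

definition simplex_chart :: "nat \<Rightarrow> (nat \<Rightarrow> real) set" where
  "simplex_chart m = {x \<in> topspace (Euclidean_space m). \<forall>i\<le>m. 0 < barycentric m x i}"

lemma continuous_map_barycentric:
  "continuous_map (Euclidean_space m) euclideanreal (\<lambda>x. barycentric m x i)"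
  unfolding barycentric_def
  by (cases "i < m"; cases "i = m")
     (auto intro!: continuous_intros continuous_map_Euclidean_space_coordinate)

lemma openin_simplex_chart: "openin (Euclidean_space m) (simplex_chart m)"
proof -
  have "simplex_chart m = topspace (Euclidean_space m) \<inter>
      (\<Inter>i\<in>{..m}. {x \<in> topspace (Euclidean_space m). barycentric m x i \<in> {0<..}})"
    by (auto simp: simplex_chart_def)
  also have "openin (Euclidean_space m) \<dots>"
    by (intro openin_Int openin_topspace openin_INT2
        openin_continuous_map_preimage[OF continuous_map_barycentric]) auto
  finally show ?thesis .
qed

lemma simplex_chart_nonempty: "simplex_chart m \<noteq> {}"
proof -
  have "(\<lambda>i. if i < m then 1 / (2 * real m) else 0) \<in> simplex_chart m"
    by (auto simp: simplex_chart_def barycentric_def topspace_Euclidean_space)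
  then show ?thesis by blast
qed

lemma barycentric_in_open_simplex:
  assumes "x \<in> simplex_chart m"
  shows "barycentric m x \<in> open_simplex {..m}"
proof -
  have "(\<Sum>i\<le>m. barycentric m x i) = 1"
    by (simp add: barycentric_def flip: lessThan_Suc_atMost)
  moreover have "0 < barycentric m x i" if "i \<le> m" for i
    using assms that by (simp add: simplex_chart_def)
  moreover have "barycentric m x i = 0" if "\<not> i \<le> m" for i
    using that by (simp add: barycentric_def)
  ultimately show ?thesis
    by (simp add: open_simplex_def)
qed

lemma barycentric_truncate:
  assumes "p \<in> open_simplex {..m}"
  shows "barycentric m (\<lambda>i. if i < m then p i else 0) = p"
proof
  fix i
  have "(\<Sum>j<m. p j) + p m = 1" and "\<And>j. \<not> j \<le> m \<Longrightarrow> p j = 0"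
    using assms by (auto simp: open_simplex_def simp flip: lessThan_Suc_atMost)
  then show "barycentric m (\<lambda>i. if i < m then p i else 0) i = p i"
    by (auto simp: barycentric_def)
qed

lemma open_simplex_atMost_homeomorphic_simplex_chart:
  "subtopology (powertop_real UNIV) (open_simplex {..m}) homeomorphic_space
    subtopology (Euclidean_space m) (simplex_chart m)"
proof -
  let ?truncate = "\<lambda>(p :: nat \<Rightarrow> real) i. if i < m then p i else 0"
  have "?truncate p \<in> simplex_chart m" if "p \<in> open_simplex {..m}" for p
    using that barycentric_truncate[OF that]
    by (auto simp: simplex_chart_def topspace_Euclidean_space open_simplex_def less_le)
  moreover have "continuous_map (powertop_real UNIV) (Euclidean_space m) ?truncate"
    by (subst continuous_map_componentwise_Euclidean_space)
       (auto intro: continuous_map_product_projection)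
  ultimately have "continuous_map (subtopology (powertop_real UNIV) (open_simplex {..m}))
      (subtopology (Euclidean_space m) (simplex_chart m)) ?truncate"
    by (auto simp: continuous_map_in_subtopology continuous_map_from_subtopology)
  moreover have "continuous_map (Euclidean_space m) (powertop_real UNIV) (barycentric m)"
    by (simp add: continuous_map_componentwise_UNIV continuous_map_barycentric)
  then have "continuous_map (subtopology (Euclidean_space m) (simplex_chart m))
      (subtopology (powertop_real UNIV) (open_simplex {..m})) (barycentric m)"
    using barycentric_in_open_simplex
    by (auto simp: continuous_map_in_subtopology continuous_map_from_subtopology)
  moreover have "?truncate (barycentric m x) = x" if "x \<in> simplex_chart m" for x
    using that by (auto simp: barycentric_def simplex_chart_def topspace_Euclidean_space)
  ultimately show ?thesis
    unfolding homeomorphic_space_def homeomorphic_maps_def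
    using barycentric_truncate by (intro exI conjI) auto
qed

lemma open_simplex_homeomorphic_simplex_chart:
  assumes "card E = Suc m"
  shows "subtopology (powertop_real UNIV) (open_simplex E) homeomorphic_space
    subtopology (Euclidean_space m) (simplex_chart m)"
proof -
  have "finite E" using assms by (simp add: card_ge_0_finite)
  then have "subtopology (powertop_real UNIV) (open_simplex E) homeomorphic_space
      subtopology (powertop_real UNIV) (open_simplex {..m})"
    using assms by (intro homeomorphic_open_simplexes) simp_all
  also note open_simplex_atMost_homeomorphic_simplex_chart
  finally show ?thesis .
qed

lemma homeomorphic_space_open_subtopology:
  assumes "X homeomorphic_space Y" and S: "openin X S"
  obtains T where "openin Y T" "subtopology X S homeomorphic_space subtopology Y T"
proof -
  obtain h where h: "homeomorphic_map X Y h"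
    using assms(1) by (auto simp: homeomorphic_space)
  have S_subset: "S \<subseteq> topspace X"
    using S by (rule openin_subset)
  have "openin Y (h ` S)"
    using S homeomorphic_map_openness_eq[OF h] by blast
  moreover have "homeomorphic_map (subtopology X S) (subtopology Y (h ` S)) h"
    using S_subset homeomorphic_imp_surjective_map[OF h]
    by (intro homeomorphic_map_subtopologies[OF h]) (auto simp: Int_absorb1 image_mono)
  ultimately show thesis
    using that homeomorphic_map_imp_homeomorphic_space by blast
qed

lemma triangulated_ball_has_nonempty_face:
  assumes "realization K homeomorphic_space closed_ball_top n"
  shows "\<not> K \<subseteq> {{}}"
proof
  assume "K \<subseteq> {{}}"
  then have "realization_points K = {}"
    by (auto simp: realization_points_eq_Union_open_simplex open_simplex_def)
  then have "closed_ball_top n = trivial_topology"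
    using homeomorphic_empty_space[OF assms] by (simp add: realization_def)
  moreover have "(\<lambda>i. 0) \<in> topspace (closed_ball_top n)"
    by (simp add: closed_ball_top_def topspace_Euclidean_space)
  ultimately show False by simp
qed

lemma card_facet_of_triangulated_ball:
  assumes K: "fin_simplicial_complex K"
    and hom: "realization K homeomorphic_space closed_ball_top n"
    and E: "facet K E"
  shows "card E = Suc n"
proof -
  have finite_E: "finite E" using K E by (auto simp: fin_simplicial_complex_def facet_def)
  moreover have "E \<noteq> {}"
    using triangulated_ball_has_nonempty_face[OF hom] E by (auto simp: facet_def)
  ultimately obtain m where m: "card E = Suc m"
    by (metis card_eq_0_iff not0_implies_Suc)
  obtain W where W: "openin (closed_ball_top n) W"
    and hom_W: "subtopology (realization K) (open_simplex E) homeomorphic_space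
      subtopology (closed_ball_top n) W"
    using homeomorphic_space_open_subtopology[OF hom openin_open_simplex_facet[OF E finite_E]] .
  have "subtopology (Euclidean_space m) (simplex_chart m) homeomorphic_space
      subtopology (powertop_real UNIV) (open_simplex E)"
    using open_simplex_homeomorphic_simplex_chart[OF m] by (subst homeomorphic_space_sym)
  also have "subtopology (powertop_real UNIV) (open_simplex E) =
      subtopology (realization K) (open_simplex E)"
  proof -
    have "open_simplex E \<subseteq> realization_points K"
      using E by (auto simp: realization_points_eq_Union_open_simplex facet_def)
    then show ?thesis by (simp add: realization_def subtopology_subtopology Int_absorb1)
  qed
  also note hom_W
  finally have "m = n"
    by (rule open_subspace_homeomorphic_open_in_ball_imp_eq[OF openin_simplex_chart simplex_chart_nonempty W])
  then show ?thesis using m by simp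
qed

lemma facet_of_max_card:
  assumes K: "fin_simplicial_complex K" and E: "E \<in> K" "card E = Max (card ` K)"
  shows "facet K E"
  unfolding facet_def
proof (intro conjI ballI impI)
  fix D assume D: "D \<in> K" "E \<subseteq> D"
  then have "finite D" "card D \<le> card E"
    using K E(2) by (auto simp: fin_simplicial_complex_def)
  then show "D = E" using card_seteq[OF _ D(2)] by simp
qed (rule E(1))

lemma Max_card_ball:
  assumes K: "fin_simplicial_complex K" and ball: "is_ball_of_dim K (int e - 1)"
  shows "K \<noteq> {}" and "Max (card ` K) = e"
proof -
  have "K \<noteq> {} \<and> Max (card ` K) = e"
  proof (cases e)
    case 0
    then show ?thesis using ball by (simp add: is_ball_of_dim_def)
  next
    case (Suc n)
    then have hom: "realization K homeomorphic_space closed_ball_top n"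
      using ball by (simp add: is_ball_of_dim_def)
    then have "K \<noteq> {}" using triangulated_ball_has_nonempty_face by blast
    moreover have "finite K" using K by (simp add: fin_simplicial_complex_def)
    ultimately have "Max (card ` K) \<in> card ` K" by (intro Max_in) auto
    then obtain E where E: "E \<in> K" "card E = Max (card ` K)" by auto
    then have "card E = Suc n"
      using card_facet_of_triangulated_ball[OF K hom] facet_of_max_card[OF K] by blast
    with \<open>K \<noteq> {}\<close> E(2) Suc show ?thesis by simp
  qed
  then show "K \<noteq> {}" "Max (card ` K) = e" by auto
qed

section \<open>Convolution over subsets\<close>

definition subset_conv :: "('v set \<Rightarrow> 'b::comm_semiring_1) \<Rightarrow> (nat \<Rightarrow> 'b) \<Rightarrow> 'v set \<Rightarrow> 'b" where
  "subset_conv g a F = (\<Sum>G\<in>Pow F. g G * a (card (F - G)))"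

definition binomial_conv :: "(nat \<Rightarrow> 'b::comm_semiring_1) \<Rightarrow> (nat \<Rightarrow> 'b) \<Rightarrow> nat \<Rightarrow> 'b" where
  "binomial_conv a b n = (\<Sum>k\<le>n. of_nat (n choose k) * a k * b (n - k))"

lemma subset_conv_cong:
  assumes "\<And>G. G \<subseteq> F \<Longrightarrow> g G = g' G"
  shows "subset_conv g a F = subset_conv g' a F"
  unfolding subset_conv_def using assms by (intro sum.cong) auto

lemma subset_conv_of_card:
  assumes "finite F"
  shows "subset_conv (\<lambda>G. a (card G)) b F = binomial_conv a b (card F)"
proof -
  have "subset_conv (\<lambda>G. a (card G)) b F = (\<Sum>G\<in>Pow F. a (card G) * b (card F - card G))"
    unfolding subset_conv_def using assms
    by (intro sum.cong) (auto simp: card_Diff_subset finite_subset)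
  also have "\<dots> = (\<Sum>k\<le>card F. \<Sum>G\<in>{G \<in> Pow F. card G = k}. a (card G) * b (card F - card G))"
    using assms by (intro sum.group[symmetric]) (auto intro: card_mono)
  also have "\<dots> = binomial_conv a b (card F)"
    unfolding binomial_conv_def using n_subsets[OF assms]
    by (intro sum.cong refl) (simp add: mult.assoc)
  finally show ?thesis .
qed

lemma subset_conv_assoc:
  assumes V: "finite V"
  shows "subset_conv (subset_conv g a) b V = subset_conv g (binomial_conv a b) V"
proof -
  have "subset_conv (subset_conv g a) b V =
      (\<Sum>F\<in>Pow V. \<Sum>G | G \<in> Pow V \<and> G \<subseteq> F. g G * (a (card (F - G)) * b (card (V - F))))"
    unfolding subset_conv_def sum_distrib_right
    by (intro sum.cong refl) (auto simp: mult.assoc intro!: sum.cong)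
  also have "\<dots> = (\<Sum>G\<in>Pow V. \<Sum>F | F \<in> Pow V \<and> G \<subseteq> F. g G * (a (card (F - G)) * b (card (V - F))))"
    using V by (intro sum.swap_restrict) auto
  also have "\<dots> = (\<Sum>G\<in>Pow V. g G * subset_conv (\<lambda>H. a (card H)) b (V - G))"
  proof (rule sum.cong[OF refl])
    fix G assume "G \<in> Pow V"
    moreover have "V - G - (F - G) = V - F" if "G \<subseteq> F" for F
      using that by blast
    ultimately show "(\<Sum>F | F \<in> Pow V \<and> G \<subseteq> F. g G * (a (card (F - G)) * b (card (V - F)))) =
        g G * subset_conv (\<lambda>H. a (card H)) b (V - G)"
      unfolding subset_conv_def sum_distrib_left
      by (intro sum.reindex_bij_witness[of _ "\<lambda>H. G \<union> H" "\<lambda>F. F - G"]) auto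
  qed
  also have "\<dots> = subset_conv g (binomial_conv a b) V"
    unfolding subset_conv_def[of g] using V by (simp add: subset_conv_of_card)
  finally show ?thesis .
qed

lemma binomial_conv_assoc:
  "binomial_conv (binomial_conv a b) c = binomial_conv a (binomial_conv b c)"
proof
  fix n :: nat
  let ?V = "{..<n}"
  have "subset_conv (subset_conv (\<lambda>G. a (card G)) b) c ?V =
      subset_conv (\<lambda>G. binomial_conv a b (card G)) c ?V"
    by (intro subset_conv_cong subset_conv_of_card) (auto intro: finite_subset)
  then show "binomial_conv (binomial_conv a b) c n = binomial_conv a (binomial_conv b c) n"
    by (simp add: subset_conv_assoc subset_conv_of_card)
qed

lemma binomial_conv_power: "binomial_conv (power x) (power y) = power (x + y)"
  by (simp add: fun_eq_iff binomial_conv_def binomial_ring)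

lemma binomial_conv_Suc:
  "binomial_conv a b (Suc n) =
    binomial_conv (\<lambda>k. a (Suc k)) b n + binomial_conv a (\<lambda>k. b (Suc k)) n"
proof -
  have "binomial_conv a (\<lambda>k. b (Suc k)) n = (\<Sum>k\<le>Suc n. of_nat (n choose k) * a k * b (Suc n - k))"
    by (simp add: binomial_conv_def Suc_diff_le binomial_eq_0)
  also have "\<dots> = a 0 * b (Suc n) + (\<Sum>k\<le>n. of_nat (n choose Suc k) * a (Suc k) * b (n - k))"
    by (subst sum.atMost_Suc_shift) simp
  finally show ?thesis
    unfolding binomial_conv_def[of _ b]
    by (subst sum.atMost_Suc_shift) (simp add: sum.distrib algebra_simps)
qed

section \<open>Eulerian and derangement polynomials\<close>

definition poly_X :: "int poly" where
  "poly_X = [:0, 1:]"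

definition eulerian_op :: "nat \<Rightarrow> int poly \<Rightarrow> int poly" where
  "eulerian_op n p = of_nat n * poly_X * p + poly_X * (1 - poly_X) * pderiv p"

primrec eulerian_poly :: "nat \<Rightarrow> int poly" where
  "eulerian_poly 0 = 1"
| "eulerian_poly (Suc n) = eulerian_poly n + eulerian_op n (eulerian_poly n)"

lemma pderiv_poly_X [simp]: "pderiv poly_X = 1"
  by (simp add: poly_X_def pderiv_pCons)

lemma eulerian_op_sum: "eulerian_op n (sum f A) = (\<Sum>i\<in>A. eulerian_op n (f i))"
  by (simp add: eulerian_op_def higher_pderiv_sum[of 1, simplified] sum.distrib sum_distrib_left)

lemma eulerian_op_mult:
  "eulerian_op (m + n) (p * q) = eulerian_op m p * q + p * eulerian_op n q"
  by (simp add: eulerian_op_def pderiv_mult algebra_simps)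

lemma eulerian_op_one_minus_X_power: "eulerian_op n ((1 - poly_X) ^ n) = 0"
proof (induction n)
  case (Suc n)
  have "eulerian_op (Suc 0) (1 - poly_X) = 0"
    by (simp add: eulerian_op_def pderiv_diff algebra_simps)
  with Suc show ?case
    using eulerian_op_mult[of 1 n "1 - poly_X" "(1 - poly_X) ^ n"] by simp
qed (simp add: eulerian_op_def)

lemma eulerian_op_X_power:
  "eulerian_op n (poly_X ^ k) = of_nat n * poly_X ^ Suc k + of_nat k * (1 - poly_X) * poly_X ^ k"
proof (induction k)
  case (Suc k)
  have "eulerian_op n (poly_X ^ Suc k) =
      poly_X * eulerian_op n (poly_X ^ k) + poly_X * (1 - poly_X) * poly_X ^ k"
    by (simp add: eulerian_op_def pderiv_mult algebra_simps)
  also have "\<dots> = of_nat n * poly_X ^ Suc (Suc k) + of_nat (Suc k) * (1 - poly_X) * poly_X ^ Suc k"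
    by (simp add: Suc.IH algebra_simps)
  finally show ?case .
qed (simp add: eulerian_op_def)

lemma eulerian_op_binomial_conv:
  "eulerian_op n (binomial_conv a b n) =
    binomial_conv (\<lambda>k. eulerian_op k (a k)) b n + binomial_conv a (\<lambda>k. eulerian_op k (b k)) n"
proof -
  have "eulerian_op n (of_nat (n choose k) * a k * b (n - k)) =
      of_nat (n choose k) * eulerian_op k (a k) * b (n - k) +
      of_nat (n choose k) * a k * eulerian_op (n - k) (b (n - k))" if "k \<le> n" for k
    using eulerian_op_mult[of 0 n "of_nat (n choose k)" "a k * b (n - k)"]
      eulerian_op_mult[of k "n - k" "a k" "b (n - k)"] that
    by (simp add: eulerian_op_def[of 0] algebra_simps)
  then show ?thesis
    by (simp add: binomial_conv_def eulerian_op_sum sum.distrib)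
qed

definition eulerian_recurrence :: "int poly \<Rightarrow> (nat \<Rightarrow> int poly) \<Rightarrow> bool" where
  "eulerian_recurrence u a \<longleftrightarrow> (\<forall>n. a (Suc n) = u * a n + eulerian_op n (a n))"

lemma eulerian_recurrence_unique:
  assumes "eulerian_recurrence u a" "eulerian_recurrence u b" "a 0 = b 0"
  shows "a = b"
proof
  show "a n = b n" for n
    using assms by (induction n) (simp_all add: eulerian_recurrence_def)
qed

lemma eulerian_recurrence_binomial_conv:
  assumes "eulerian_recurrence u a" "eulerian_recurrence v b"
  shows "eulerian_recurrence (u + v) (binomial_conv a b)"
  unfolding eulerian_recurrence_def
proof
  fix n
  have "binomial_conv (\<lambda>k. a (Suc k)) b n =
      u * binomial_conv a b n + binomial_conv (\<lambda>k. eulerian_op k (a k)) b n"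
    using assms(1)
    by (simp add: eulerian_recurrence_def binomial_conv_def algebra_simps sum_distrib_left sum.distrib)
  moreover have "binomial_conv a (\<lambda>k. b (Suc k)) n =
      v * binomial_conv a b n + binomial_conv a (\<lambda>k. eulerian_op k (b k)) n"
    using assms(2)
    by (simp add: eulerian_recurrence_def binomial_conv_def algebra_simps sum_distrib_left sum.distrib)
  ultimately show "binomial_conv a b (Suc n) =
      (u + v) * binomial_conv a b n + eulerian_op n (binomial_conv a b n)"
    by (simp add: binomial_conv_Suc eulerian_op_binomial_conv algebra_simps)
qed

lemma eulerian_recurrence_eulerian_poly: "eulerian_recurrence 1 eulerian_poly"
  by (simp add: eulerian_recurrence_def)

lemma eulerian_recurrence_one_minus_X_power:
  "eulerian_recurrence (1 - poly_X) (power (1 - poly_X))"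
  by (simp add: eulerian_recurrence_def eulerian_op_one_minus_X_power)

primrec boundary_weight :: "nat \<Rightarrow> int poly" where
  "boundary_weight 0 = 1"
| "boundary_weight (Suc k) = (1 - poly_X) ^ Suc k - (1 - poly_X) ^ k"

lemma eulerian_recurrence_boundary_weight: "eulerian_recurrence (- poly_X) boundary_weight"
proof -
  have "boundary_weight (Suc n) = - poly_X * boundary_weight n + eulerian_op n (boundary_weight n)"
    for n
  proof (cases n)
    case 0
    then show ?thesis by (simp add: eulerian_op_def)
  next
    case (Suc k)
    have "boundary_weight n = - poly_X * (1 - poly_X) ^ k"
      using Suc by (simp add: algebra_simps)
    moreover have "eulerian_op (Suc k) (- poly_X * (1 - poly_X) ^ k) =
        eulerian_op 1 (- poly_X) * (1 - poly_X) ^ k"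
      using eulerian_op_mult[of 1 k "- poly_X" "(1 - poly_X) ^ k"]
      by (simp add: eulerian_op_one_minus_X_power)
    moreover have "eulerian_op 1 (- poly_X) = - poly_X"
      by (simp add: eulerian_op_def pderiv_minus algebra_simps)
    ultimately show ?thesis
      using Suc by (simp add: algebra_simps)
  qed
  then show ?thesis unfolding eulerian_recurrence_def by blast
qed

lemma boundary_weight_conv_eulerian_poly:
  "binomial_conv boundary_weight eulerian_poly = power (1 - poly_X)"
proof (rule eulerian_recurrence_unique)
  show "eulerian_recurrence (1 - poly_X) (binomial_conv boundary_weight eulerian_poly)"
    using eulerian_recurrence_binomial_conv[OF eulerian_recurrence_boundary_weight
        eulerian_recurrence_eulerian_poly] by simp
qed (simp_all add: eulerian_recurrence_one_minus_X_power binomial_conv_def)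

definition excedances :: "'a::linorder set \<Rightarrow> ('a \<Rightarrow> 'a) \<Rightarrow> 'a set" where
  "excedances S \<pi> = {i \<in> S. i < \<pi> i}"

definition derangements :: "'a set \<Rightarrow> ('a \<Rightarrow> 'a) set" where
  "derangements S = {\<pi>. \<pi> permutes S \<and> (\<forall>i\<in>S. \<pi> i \<noteq> i)}"

lemma sum_X_power_card_insert:
  assumes S: "finite S" and T: "T \<subseteq> S"
  shows "(\<Sum>i\<in>S. poly_X ^ card (insert i T)) = eulerian_op (card S) (poly_X ^ card T)"
proof -
  have finite_T: "finite T" using assms finite_subset by blast
  have "(\<Sum>i\<in>S. poly_X ^ card (insert i T)) =
      (\<Sum>i\<in>S - T. poly_X ^ card (insert i T)) + (\<Sum>i\<in>T. poly_X ^ card (insert i T))"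
    by (rule sum.subset_diff[OF T S])
  also have "(\<Sum>i\<in>S - T. poly_X ^ card (insert i T)) = of_nat (card (S - T)) * poly_X ^ Suc (card T)"
    using finite_T by simp
  also have "(\<Sum>i\<in>T. poly_X ^ card (insert i T)) = of_nat (card T) * poly_X ^ card T"
    by (simp add: insert_absorb)
  also have "of_nat (card (S - T)) * poly_X ^ Suc (card T) + of_nat (card T) * poly_X ^ card T =
      eulerian_op (card S) (poly_X ^ card T)"
    using assms finite_T
    by (simp add: eulerian_op_X_power card_Diff_subset card_mono algebra_simps)
  finally show ?thesis .
qed

text \<open>A permutation of \<open>S \<union> {m}\<close> moving \<open>m\<close> arises from a permutation \<open>q\<close> of \<open>S\<close> by inserting \<open>m\<close>
  between \<open>i\<close> and \<open>q i\<close> in a cycle of \<open>q\<close>.\<close>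

lemma excedances_insert:
  assumes q: "q permutes S" and m: "\<And>j. j \<in> S \<Longrightarrow> j < m" and i: "i \<in> S"
  shows "excedances (insert m S) (Transposition.transpose m (q i) \<circ> q) = insert i (excedances S q)"
proof -
  have m_notin: "m \<notin> S" using m by blast
  then have q_m: "q m = m" using q by (simp add: permutes_not_in)
  have q_in_S: "q j \<in> S" if "j \<in> S" for j
    using permutes_in_image[OF q] that by simp
  have "(Transposition.transpose m (q i) \<circ> q) j = (if j = i then m else q j)" if "j \<in> S" for j
    using q_in_S[OF that] m_notin permutes_inj[OF q] by (auto simp: Transposition.transpose_def dest: injD)
  moreover have "(Transposition.transpose m (q i) \<circ> q) m < m"
    using q_m m q_in_S[OF i] by simp
  ultimately show ?thesis
    using m i by (auto simp: excedances_def)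
qed

lemma sum_excedances_insert:
  assumes S: "finite S" and m: "\<And>j. j \<in> S \<Longrightarrow> j < m"
  shows "(\<Sum>\<pi> | \<pi> permutes insert m S. poly_X ^ card (excedances (insert m S) \<pi>)) =
    (\<Sum>\<pi> | \<pi> permutes S. poly_X ^ card (excedances S \<pi>)) +
    eulerian_op (card S) (\<Sum>\<pi> | \<pi> permutes S. poly_X ^ card (excedances S \<pi>))"
proof -
  let ?P = "{\<pi>. \<pi> permutes S}"
  let ?wt = "\<lambda>\<pi>. poly_X ^ card (excedances (insert m S) \<pi>)"
  have m_notin: "m \<notin> S" using m by blast
  have "(\<Sum>\<pi> | \<pi> permutes insert m S. ?wt \<pi>) =
      (\<Sum>\<pi>\<in>?P. ?wt \<pi>) + (\<Sum>b\<in>S. \<Sum>\<pi>\<in>?P. ?wt (Transposition.transpose m b \<circ> \<pi>))"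
    using S m_notin by (simp add: sum_over_permutations_insert)
  also have "(\<Sum>\<pi>\<in>?P. ?wt \<pi>) = (\<Sum>\<pi>\<in>?P. poly_X ^ card (excedances S \<pi>))"
  proof -
    have "excedances (insert m S) \<pi> = excedances S \<pi>" if "\<pi> permutes S" for \<pi>
      using permutes_not_in[OF that m_notin] by (auto simp: excedances_def)
    then show ?thesis by simp
  qed
  also have "(\<Sum>b\<in>S. \<Sum>\<pi>\<in>?P. ?wt (Transposition.transpose m b \<circ> \<pi>)) =
      (\<Sum>\<pi>\<in>?P. \<Sum>b\<in>S. ?wt (Transposition.transpose m b \<circ> \<pi>))"
    by (rule sum.swap)
  also have "\<dots> = (\<Sum>\<pi>\<in>?P. \<Sum>i\<in>S. ?wt (Transposition.transpose m (\<pi> i) \<circ> \<pi>))"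
    by (intro sum.cong refl sum.reindex_bij_betw[symmetric]) (simp add: permutes_imp_bij)
  also have "\<dots> = (\<Sum>\<pi>\<in>?P. \<Sum>i\<in>S. poly_X ^ card (insert i (excedances S \<pi>)))"
    using m by (simp add: excedances_insert)
  also have "\<dots> = (\<Sum>\<pi>\<in>?P. eulerian_op (card S) (poly_X ^ card (excedances S \<pi>)))"
    using S by (intro sum.cong refl sum_X_power_card_insert) (auto simp: excedances_def)
  finally show ?thesis by (simp only: eulerian_op_sum)
qed

lemma eulerian_poly_eq_sum_excedances:
  assumes "finite S"
  shows "eulerian_poly (card S) = (\<Sum>\<pi> | \<pi> permutes S. poly_X ^ card (excedances S \<pi>))"
  using assms
proof (induction S rule: finite_linorder_max_induct)
  case empty
  then show ?case by (simp add: excedances_def)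
next
  case (insert m S)
  then have "m \<notin> S" by blast
  with insert show ?case by (simp add: sum_excedances_insert)
qed

lemma sum_permutations_by_support:
  assumes S: "finite S"
  shows "(\<Sum>\<pi> | \<pi> permutes S. f \<pi>) = (\<Sum>T\<in>Pow S. \<Sum>\<pi>\<in>derangements T. f \<pi>)"
proof -
  have "(\<Sum>\<pi> | \<pi> permutes S. f \<pi>) =
      (\<Sum>T\<in>Pow S. \<Sum>\<pi>\<in>{\<pi> \<in> {\<pi>. \<pi> permutes S}. {i. \<pi> i \<noteq> i} = T}. f \<pi>)"
    using S by (intro sum.group[symmetric]) (auto simp: finite_permutations dest: permutes_not_in)
  also have "\<dots> = (\<Sum>T\<in>Pow S. \<Sum>\<pi>\<in>derangements T. f \<pi>)"
    by (intro sum.cong refl) (auto simp: derangements_def permutes_def)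
  finally show ?thesis .
qed

lemma eulerian_poly_eq_sum_derangements:
  fixes S :: "'a::linorder set"
  assumes S: "finite S"
  shows "eulerian_poly (card S) =
    (\<Sum>T\<in>Pow S. \<Sum>\<pi>\<in>derangements T. poly_X ^ card (excedances T \<pi>))"
proof -
  have "excedances S \<pi> = excedances T \<pi>" if "T \<in> Pow S" "\<pi> \<in> derangements T" for T \<pi>
    using that by (auto simp: excedances_def derangements_def permutes_def)
  then show ?thesis
    by (simp add: eulerian_poly_eq_sum_excedances[OF S] sum_permutations_by_support[OF S])
qed

lemma derangement_poly_eq_conv: "derangement_poly = binomial_conv eulerian_poly (power (- 1))"
proof
  fix n :: nat
  let ?S = "{1..n}"
  have "derangement_poly n = (\<Sum>\<pi>\<in>derangements ?S. poly_X ^ card (excedances ?S \<pi>))"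
    by (simp add: derangement_poly_def derangements_def exc_def excedances_def poly_X_def)
  also have "\<dots> = (\<Sum>T\<in>Pow ?S. (- 1) ^ (card ?S - card T) * eulerian_poly (card T))"
    by (rule inclusion_exclusion_mobius[OF eulerian_poly_eq_sum_derangements]) auto
  also have "\<dots> = subset_conv (\<lambda>T. eulerian_poly (card T)) (power (- 1)) ?S"
    unfolding subset_conv_def
    by (intro sum.cong refl) (auto simp: card_Diff_subset finite_subset mult.commute)
  finally show "derangement_poly n = binomial_conv eulerian_poly (power (- 1)) n"
    by (simp add: subset_conv_of_card)
qed

lemma boundary_weight_conv_derangement_poly:
  "binomial_conv boundary_weight derangement_poly = power (- poly_X)"
  by (simp add: derangement_poly_eq_conv binomial_conv_assoc[symmetric]
      boundary_weight_conv_eulerian_poly binomial_conv_power)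

section \<open>Counting faces by carrier\<close>

definition carrier_poly :: "'a set set \<Rightarrow> ('a set \<Rightarrow> 'v set) \<Rightarrow> 'v set \<Rightarrow> int poly" where
  "carrier_poly \<Delta> \<sigma> G =
    (\<Sum>E | E \<in> \<Delta> \<and> \<sigma> E = G. poly_X ^ card E * (1 - poly_X) ^ (card G - card E))"

lemma h_poly_eq_sum_faces:
  assumes "finite K" "Max (card ` K) = e"
  shows "h_poly K = (\<Sum>E\<in>K. poly_X ^ card E * (1 - poly_X) ^ (e - card E))"
proof -
  have "card ` K \<subseteq> {0..e}"
    using assms by auto
  then have "(\<Sum>E\<in>K. poly_X ^ card E * (1 - poly_X) ^ (e - card E)) =
      (\<Sum>i\<in>{0..e}. \<Sum>E\<in>{E \<in> K. card E = i}. poly_X ^ card E * (1 - poly_X) ^ (e - card E))"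
    by (intro sum.group[OF assms(1), symmetric]) simp
  also have "\<dots> = (\<Sum>i\<in>{0..e}. of_nat (num_faces K i) * poly_X ^ i * (1 - poly_X) ^ (e - i))"
    by (intro sum.cong refl) (simp add: num_faces_def mult.assoc)
  finally show ?thesis
    using assms(2) by (simp add: h_poly_def poly_X_def one_pCons)
qed

lemma h_poly_eq_sum_carriers:
  assumes \<Delta>: "finite \<Delta>" and le_carrier: "\<And>E. E \<in> \<Delta> \<Longrightarrow> card E \<le> card (\<sigma> E)"
    and P: "finite P" "\<And>G. G \<in> P \<Longrightarrow> card G \<le> e"
    and Max: "Max (card ` {E \<in> \<Delta>. \<sigma> E \<in> P}) = e"
  shows "h_poly {E \<in> \<Delta>. \<sigma> E \<in> P} = (\<Sum>G\<in>P. carrier_poly \<Delta> \<sigma> G * (1 - poly_X) ^ (e - card G))"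
proof -
  let ?wt = "\<lambda>E. poly_X ^ card E * (1 - poly_X) ^ (e - card E)"
  have "h_poly {E \<in> \<Delta>. \<sigma> E \<in> P} = (\<Sum>E | E \<in> \<Delta> \<and> \<sigma> E \<in> P. ?wt E)"
    using \<Delta> Max by (intro h_poly_eq_sum_faces) auto
  also have "\<dots> = (\<Sum>G\<in>P. \<Sum>E\<in>{E \<in> {E \<in> \<Delta>. \<sigma> E \<in> P}. \<sigma> E = G}. ?wt E)"
    using \<Delta> P(1) by (intro sum.group[symmetric]) auto
  also have "\<dots> = (\<Sum>G\<in>P. carrier_poly \<Delta> \<sigma> G * (1 - poly_X) ^ (e - card G))"
  proof (intro sum.cong refl)
    fix G assume G: "G \<in> P"
    have "?wt E = poly_X ^ card E * (1 - poly_X) ^ (card G - card E) * (1 - poly_X) ^ (e - card G)"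
      if "E \<in> \<Delta>" "\<sigma> E = G" for E
      using le_carrier[OF that(1)] P(2)[OF G] that(2) by (simp add: mult.assoc flip: power_add)
    then show "(\<Sum>E\<in>{E \<in> {E \<in> \<Delta>. \<sigma> E \<in> P}. \<sigma> E = G}. ?wt E) =
        carrier_poly \<Delta> \<sigma> G * (1 - poly_X) ^ (e - card G)"
      unfolding carrier_poly_def sum_distrib_right using G by (intro sum.cong) auto
  qed
  finally show ?thesis .
qed

lemma restr_eq_carriers: "restr \<Delta> \<sigma> F = {E \<in> \<Delta>. \<sigma> E \<in> Pow F}"
  by (simp add: restr_def)

lemma restr_boundary_eq_carriers: "restr_boundary \<Delta> \<sigma> F = {E \<in> \<Delta>. \<sigma> E \<in> Pow F - {F}}"
  by (auto simp: restr_boundary_def restr_def)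

lemma local_h_poly_eq_conv:
  assumes "finite V"
  shows "local_h_poly V \<Delta> \<sigma> = subset_conv (\<lambda>F. h_poly (restr \<Delta> \<sigma> F)) (power (- 1)) V"
  unfolding local_h_poly_def subset_conv_def using assms
  by (intro sum.cong refl) (auto simp: card_Diff_subset finite_subset mult.commute)

lemma card_proper_subset_le:
  assumes "finite F" and "G \<in> Pow F - {F}"
  shows "card G \<le> card F - 1"
proof -
  have "G \<subset> F" using assms(2) by blast
  then show ?thesis using psubset_card_mono[OF assms(1), of G] by linarith
qed

locale simplex_subdivision =
  fixes V :: "'v set" and \<Delta> :: "'a set set" and \<sigma> :: "'a set \<Rightarrow> 'v set"
  assumes finite_V: "finite V" and subdivision: "is_subdivision V \<Delta> \<sigma>"
begin

lemma finite_subset_V: "F \<subseteq> V \<Longrightarrow> finite F"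
  using finite_V by (rule rev_finite_subset)

lemma finite_subdivision: "finite \<Delta>"
  using subdivision by (simp add: is_subdivision_def fin_simplicial_complex_def)

lemma
  assumes "F \<subseteq> V"
  shows restr_nonempty: "restr \<Delta> \<sigma> F \<noteq> {}"
    and Max_card_restr: "Max (card ` restr \<Delta> \<sigma> F) = card F"
  using Max_card_ball[of "restr \<Delta> \<sigma> F" "card F"] subdivision assms
  by (auto simp: is_subdivision_def)

lemma card_face_le_carrier:
  assumes "E \<in> \<Delta>"
  shows "card E \<le> card (\<sigma> E)"
proof -
  have "\<sigma> E \<subseteq> V" using subdivision assms by (auto simp: is_subdivision_def)
  moreover have "E \<in> restr \<Delta> \<sigma> (\<sigma> E)" "finite (restr \<Delta> \<sigma> (\<sigma> E))"
    using assms finite_subdivision by (simp_all add: restr_def)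
  ultimately show ?thesis using Max_card_restr by (metis Max_ge finite_imageI imageI)
qed

lemma Max_card_restr_boundary:
  assumes F: "F \<subseteq> V" "F \<noteq> {}"
  shows "Max (card ` restr_boundary \<Delta> \<sigma> F) = card F - 1"
proof -
  obtain v where v: "v \<in> F" using F by blast
  have diff_subset_V: "F - {v} \<subseteq> V" using F by blast
  have "Max (card ` restr \<Delta> \<sigma> (F - {v})) \<in> card ` restr \<Delta> \<sigma> (F - {v})"
    using restr_nonempty[OF diff_subset_V] finite_subdivision by (intro Max_in) (auto simp: restr_def)
  then obtain E where "E \<in> restr \<Delta> \<sigma> (F - {v})" "card E = card F - 1"
    using Max_card_restr[OF diff_subset_V] v by auto
  moreover from this have "E \<in> restr_boundary \<Delta> \<sigma> F"
    using v by (auto simp: restr_boundary_eq_carriers restr_def)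
  moreover have "card E \<le> card F - 1" if "E \<in> restr_boundary \<Delta> \<sigma> F" for E
    using that card_face_le_carrier[of E]
      card_proper_subset_le[OF finite_subset_V[OF F(1)], of "\<sigma> E"]
    by (simp add: restr_boundary_eq_carriers)
  ultimately show ?thesis
    using finite_subdivision
    by (intro Max_eqI) (auto simp: restr_boundary_eq_carriers image_iff intro: sym)
qed

lemma h_poly_restr:
  assumes F: "F \<subseteq> V"
  shows "h_poly (restr \<Delta> \<sigma> F) = subset_conv (carrier_poly \<Delta> \<sigma>) (power (1 - poly_X)) F"
proof -
  have "h_poly (restr \<Delta> \<sigma> F) =
      (\<Sum>G\<in>Pow F. carrier_poly \<Delta> \<sigma> G * (1 - poly_X) ^ (card F - card G))"
    unfolding restr_eq_carriers using Max_card_restr[OF F] finite_subset_V[OF F]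
    by (intro h_poly_eq_sum_carriers finite_subdivision card_face_le_carrier)
       (auto simp: restr_eq_carriers intro: card_mono)
  also have "\<dots> = subset_conv (carrier_poly \<Delta> \<sigma>) (power (1 - poly_X)) F"
    unfolding subset_conv_def using finite_subset_V[OF F]
    by (intro sum.cong refl) (auto simp: card_Diff_subset finite_subset)
  finally show ?thesis .
qed

lemma h_poly_restr_boundary:
  assumes F: "F \<subseteq> V"
  shows "h_poly (restr_boundary \<Delta> \<sigma> F) =
    (\<Sum>G\<in>Pow F - {F}. carrier_poly \<Delta> \<sigma> G * (1 - poly_X) ^ (card (F - G) - 1))"
proof (cases "F = {}")
  case True
  then show ?thesis by (simp add: restr_boundary_empty h_poly_void)
next
  case False
  have "h_poly (restr_boundary \<Delta> \<sigma> F) =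
      (\<Sum>G\<in>Pow F - {F}. carrier_poly \<Delta> \<sigma> G * (1 - poly_X) ^ (card F - 1 - card G))"
    unfolding restr_boundary_eq_carriers
    using Max_card_restr_boundary[OF F False] card_proper_subset_le finite_subset_V[OF F]
    by (intro h_poly_eq_sum_carriers finite_subdivision card_face_le_carrier)
       (auto simp: restr_boundary_eq_carriers)
  also have "\<dots> = (\<Sum>G\<in>Pow F - {F}. carrier_poly \<Delta> \<sigma> G * (1 - poly_X) ^ (card (F - G) - 1))"
    using finite_subset_V[OF F]
    by (intro sum.cong refl) (auto simp: card_Diff_subset finite_subset diff_commute)
  finally show ?thesis .
qed

lemma h_poly_restr_minus_boundary:
  assumes F: "F \<subseteq> V"
  shows "h_poly (restr \<Delta> \<sigma> F) - h_poly (restr_boundary \<Delta> \<sigma> F) =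
    subset_conv (carrier_poly \<Delta> \<sigma>) boundary_weight F"
proof -
  let ?g = "carrier_poly \<Delta> \<sigma>" and ?w = "1 - poly_X"
  have finite_F: "finite F" using F by (rule finite_subset_V)
  have split_top: "subset_conv ?g a F = (\<Sum>G\<in>Pow F - {F}. ?g G * a (card (F - G))) + ?g F * a 0"
    for a
    unfolding subset_conv_def using finite_F by (subst sum.remove[of _ F]) (auto simp: add.commute)
  have "?g G * ?w ^ card (F - G) - ?g G * ?w ^ (card (F - G) - 1) =
      ?g G * boundary_weight (card (F - G))" if "G \<in> Pow F - {F}" for G
  proof -
    have "card (F - G) \<noteq> 0" using that finite_F by auto
    then obtain k where "card (F - G) = Suc k" by (metis not0_implies_Suc)
    then show ?thesis by (simp add: algebra_simps)
  qed
  then show ?thesis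
    by (simp add: h_poly_restr[OF F] h_poly_restr_boundary[OF F] split_top flip: sum_subtractf)
qed

end

theorem theorem4p4:
  fixes V :: "'v set" and \<Delta> :: "'a set set" and \<sigma> :: "'a set \<Rightarrow> 'v set"
  assumes "finite V" and "V \<noteq> {}"
    and "is_subdivision V \<Delta> \<sigma>"
  shows "local_h_poly V \<Delta> \<sigma> =
    (\<Sum>F\<in>Pow V. (h_poly (restr \<Delta> \<sigma> F) - h_poly (restr_boundary \<Delta> \<sigma> F))
                  * derangement_poly (card (V - F)))"
proof -
  interpret simplex_subdivision V \<Delta> \<sigma>
    using assms by unfold_locales
  let ?g = "carrier_poly \<Delta> \<sigma>"
  have "local_h_poly V \<Delta> \<sigma> = subset_conv (subset_conv ?g (power (1 - poly_X))) (power (- 1)) V"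
    unfolding local_h_poly_eq_conv[OF finite_V] by (intro subset_conv_cong h_poly_restr)
  also have "\<dots> = subset_conv ?g (power (- poly_X)) V"
    by (simp add: subset_conv_assoc[OF finite_V] binomial_conv_power)
  also have "\<dots> = subset_conv (subset_conv ?g boundary_weight) derangement_poly V"
    by (simp only: subset_conv_assoc[OF finite_V] boundary_weight_conv_derangement_poly)
  also have "\<dots> = subset_conv (\<lambda>F. h_poly (restr \<Delta> \<sigma> F) - h_poly (restr_boundary \<Delta> \<sigma> F))
      derangement_poly V"
    by (intro subset_conv_cong h_poly_restr_minus_boundary[symmetric])
  finally show ?thesis by (simp only: subset_conv_def)
qed

end
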